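(* Let $\mathbb{K}$ be a field and let $m_1,\dots,m_5$ be non-negative integers. Write $P=m_1m_2m_3m_4m_5$; all summation indices below range over $\{1,\dots,5\}$. The number of dominant monomial ideals in $\mathbb{K}[x_1,\dots,x_5]$ whose lcm is $x_1^{m_1}\cdots x_5^{m_5}$ is $$\begin{aligned} &1+P^4+\sum_{i<j}m_im_j+3\sum_{i<j<k}m_im_jm_k+7\sum_{i<j<k<\ell}m_im_jm_km_\ell+15P\\ &+10P^3+\sum_{i<j<k<\ell}(m_im_jm_km_\ell)^3+6P^2\sum_{i<j<k<\ell}m_im_jm_km_\ell+4P\sum_{i<j<k<\ell}(m_im_jm_km_\ell)^2\\ &+25P^2+\sum_{i<j<k}(m_im_jm_k)^2+6\sum_{i<j<k<\ell}(m_im_jm_km_\ell)^2\\ &+9P\sum_{i<j<k}m_im_jm_k+18P\sum_{i<j<k<\ell}m_im_jm_km_\ell\\ &+3\sum_{i=1}^{5}m_i\sum_{\substack{j<k<\ell\\ j,k,\ell\neq i}}(m_jm_km_\ell)^2 . \end{aligned}$$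
   Context: Let $S$ be a polynomial ring over a field in finitely many variables. For a monomial $u$ and a variable $x_i$, $\deg_{x_i}u$ denotes the exponent of $x_i$ in $u$. For a monomial ideal $I$, $G(I)$ denotes its unique minimal set of monomial generators. A monomial $v$ in a finite set $L$ of monomials is dominant in $L$ if there is a variable $x_i$ with $\deg_{x_i}v>\deg_{x_i}w$ for all $w\in L\setminus\{v\}$. The set $L$ is a dominant set if every element of $L$ is dominant in $L$ (in particular, a one-element set is dominant), and $I$ is a dominant ideal if $G(I)$ is a dominant set. The lcm of a nonzero monomial ideal $I$ is the least common multiple of the elements of $G(I)$; the zero ideal is not assigned an lcm and is not counted. *)

theory Defs
  imports Complex_Main "HOL-Library.Poly_Mapping" "HOL-Library.Numeral_Type"
begin

text \<open>
  The polynomial ring over a field \<open>'k\<close> in the finite set of variables \<open>'v\<close> is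
  \<open>('v \<Rightarrow>\<^sub>0 nat) \<Rightarrow>\<^sub>0 'k\<close>. A monomial is represented by its exponent vector
  \<open>u :: 'v \<Rightarrow>\<^sub>0 nat\<close>, so that \<open>lookup u i\<close> is the degree of \<open>u\<close> in the variable \<open>i\<close> and
  the product of monomials is the sum of exponent vectors.
\<close>

type_synonym 'v monom = "'v \<Rightarrow>\<^sub>0 nat"
type_synonym ('v, 'k) mpoly = "'v monom \<Rightarrow>\<^sub>0 'k"

text \<open>Ideals of a commutative ring are its submodules; \<open>ideal_gen B\<close> is the ideal generated by \<open>B\<close>.\<close>

global_interpretation ideal: module "(*) :: 'a \<Rightarrow> 'a \<Rightarrow> 'a::comm_ring_1"
  defines ideal_gen = ideal.span
  by unfold_locales (simp_all add: algebra_simps)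

definition monomials :: "'v monom set \<Rightarrow> ('v, 'k::field) mpoly set" where
  "monomials U = (\<lambda>u. Poly_Mapping.single u 1) ` U"

definition monomial_ideal :: "('v::finite, 'k::field) mpoly set \<Rightarrow> bool" where
  "monomial_ideal I \<longleftrightarrow> (\<exists>U. I = ideal_gen (monomials U))"

definition min_monomial_gens :: "('v::finite, 'k::field) mpoly set \<Rightarrow> 'v monom set \<Rightarrow> bool" where
  "min_monomial_gens I G \<longleftrightarrow>
     ideal_gen (monomials G) = I \<and> (\<forall>H. H \<subset> G \<longrightarrow> ideal_gen (monomials H) \<noteq> I)"

text \<open>The set $G(I)$; it is meaningful only for monomial ideals \<open>I\<close>, and empty for the zero ideal.\<close>

definition min_gens :: "('v::finite, 'k::field) mpoly set \<Rightarrow> 'v monom set" where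
  "min_gens I = (THE G. min_monomial_gens I G)"

definition dominant_in :: "'v monom set \<Rightarrow> 'v monom \<Rightarrow> bool" where
  "dominant_in L v \<longleftrightarrow>
     v \<in> L \<and> (\<exists>i. \<forall>w \<in> L - {v}. Poly_Mapping.lookup w i < Poly_Mapping.lookup v i)"

definition dominant_set :: "'v monom set \<Rightarrow> bool" where
  "dominant_set L \<longleftrightarrow> finite L \<and> (\<forall>v \<in> L. dominant_in L v)"

definition dominant_ideal :: "('v::finite, 'k::field) mpoly set \<Rightarrow> bool" where
  "dominant_ideal I \<longleftrightarrow> monomial_ideal I \<and> dominant_set (min_gens I)"

definition monom_dvd :: "'v monom \<Rightarrow> 'v monom \<Rightarrow> bool" where
  "monom_dvd u v \<longleftrightarrow> (\<exists>w. v = u + w)"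

definition is_lcm_of :: "'v monom \<Rightarrow> 'v monom set \<Rightarrow> bool" where
  "is_lcm_of m L \<longleftrightarrow>
     (\<forall>u \<in> L. monom_dvd u m) \<and> (\<forall>n. (\<forall>u \<in> L. monom_dvd u n) \<longrightarrow> monom_dvd m n)"

text \<open>The zero ideal has no lcm. It is excluded explicitly because the condition on the
  empty set of generators would make the monomial 1 its lcm.\<close>

definition ideal_has_lcm :: "('v::finite, 'k::field) mpoly set \<Rightarrow> 'v monom \<Rightarrow> bool" where
  "ideal_has_lcm I m \<longleftrightarrow> I \<noteq> {0} \<and> is_lcm_of m (min_gens I)"

text \<open>The exponent vector of $x_1^{m_1} \cdots x_n^{m_n}$, as the product of the powers of
  the variables. For five variables the index type is the numeral type \<open>5\<close>, whose elements
  \<open>0 < 1 < 2 < 3 < 4\<close> stand for the indices $1 < \dots < 5$.\<close>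

definition monom_of :: "('v::finite \<Rightarrow> nat) \<Rightarrow> 'v monom" where
  "monom_of m = (\<Sum>i\<in>UNIV. Poly_Mapping.single i (m i))"

end

theory Submission
  imports Defs "HOL-Library.FuncSet" "HOL-Combinatorics.Multiset_Permutations"
begin

text \<open>
  A dominant set is an antichain for divisibility, hence equals the minimal generating set of the
  ideal it generates; so dominant ideals correspond to nonempty dominant sets. Enumerating a dominant
  set with lcm $x^m$ as $q$ monomials gives $q!$ matrices whose column $i$ has entries in
  $\{0,\dots,m_i\}$ with maximum $m_i$, and in which every row contains the unique maximum of some
  column. There are $(m_i+1)^q - m_i^q - t m_i^{q-1}$ columns whose unique maximum, if any, lies outside
  $t$ given rows, so inclusion-exclusion counts the matrices as
  $\sum_t (-1)^t \binom{q}{t} \prod_i ((m_i+1)^q - m_i^q - t m_i^{q-1})$. Distinct rows need distinct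
  columns, so $q$ is at most the number of variables, and summing over $q \le 5$ gives the formula.
\<close>

subsection \<open>Minimal generators of monomial ideals\<close>

lemma monom_dvd_iff: "monom_dvd u v \<longleftrightarrow> (\<forall>i. Poly_Mapping.lookup u i \<le> Poly_Mapping.lookup v i)"
proof
  assume le: "\<forall>i. Poly_Mapping.lookup u i \<le> Poly_Mapping.lookup v i"
  have "v = u + (v - u)"
    by (rule poly_mapping_eqI) (simp add: lookup_add lookup_minus le)
  then show "monom_dvd u v" unfolding monom_dvd_def ..
qed (auto simp: monom_dvd_def lookup_add)

lemma monom_dvd_refl: "monom_dvd u u" and
  monom_dvd_trans: "monom_dvd u v \<Longrightarrow> monom_dvd v w \<Longrightarrow> monom_dvd u w"
  by (auto simp: monom_dvd_iff intro: order_trans)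

text \<open>Being supported on multiples of \<open>U\<close> passes to linear combinations: every
  key of \<open>c * x\<close> with \<open>x\<close> a monomial is a shift of the exponent of
  \<open>x\<close>, and a sum brings in no new keys.\<close>

lemma keys_ideal_gen_monomials:
  assumes "p \<in> ideal_gen (monomials U :: ('v::finite, 'k::field) mpoly set)" "t \<in> Poly_Mapping.keys p"
  shows "\<exists>w\<in>U. monom_dvd w t"
proof -
  have "\<forall>t\<in>Poly_Mapping.keys p. \<exists>w\<in>U. monom_dvd w t"
    using assms(1)
  proof (induction rule: ideal.span_induct_alt)
    case (step c x y)
    then obtain w where w: "w \<in> U" "x = Poly_Mapping.single w 1"
      by (auto simp: monomials_def)
    have "monom_dvd w t" if "t \<in> Poly_Mapping.keys (c * x)" for t
      using keys_mult[of c x] that w(2) by (auto simp: monom_dvd_def add.commute)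
    with step.IH w(1) show ?case
      using keys_add[of "c * x" y] by blast
  qed auto
  with assms(2) show ?thesis by blast
qed

text \<open>Reduces ideal membership of a monomial to divisibility: its only key must be a multiple
  of a generator, and conversely the cofactor exhibits it as such a multiple.\<close>

lemma single_in_ideal_gen_monomials_iff:
  "Poly_Mapping.single u 1 \<in> ideal_gen (monomials U :: ('v::finite, 'k::field) mpoly set)
     \<longleftrightarrow> (\<exists>w\<in>U. monom_dvd w u)"
proof
  assume "Poly_Mapping.single u 1 \<in> ideal_gen (monomials U :: ('v, 'k) mpoly set)"
  then show "\<exists>w\<in>U. monom_dvd w u"
    by (rule keys_ideal_gen_monomials) simp
next
  assume "\<exists>w\<in>U. monom_dvd w u"
  then obtain w v where w: "w \<in> U" "u = v + w" by (auto simp: monom_dvd_def add.commute)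
  have "Poly_Mapping.single v 1 * Poly_Mapping.single w 1 \<in> ideal_gen (monomials U :: ('v, 'k) mpoly set)"
    using w(1) by (intro ideal.span_scale ideal.span_base) (auto simp: monomials_def)
  then show "Poly_Mapping.single u 1 \<in> ideal_gen (monomials U :: ('v, 'k) mpoly set)"
    by (simp add: w(2) mult_single)
qed

lemma ideal_gen_monomials_subset_iff:
  "ideal_gen (monomials U :: ('v::finite, 'k::field) mpoly set) \<subseteq> ideal_gen (monomials W)
     \<longleftrightarrow> (\<forall>u\<in>U. \<exists>w\<in>W. monom_dvd w u)"
proof -
  have "ideal_gen (monomials U :: ('v, 'k) mpoly set) \<subseteq> ideal_gen (monomials W)
     \<longleftrightarrow> monomials U \<subseteq> ideal_gen (monomials W :: ('v, 'k) mpoly set)"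
    by (meson ideal.span_minimal ideal.span_superset ideal.subspace_span order_trans)
  also have "\<dots> \<longleftrightarrow> (\<forall>u\<in>U. \<exists>w\<in>W. monom_dvd w u)"
    unfolding single_in_ideal_gen_monomials_iff[symmetric, where 'k='k] by (auto simp: monomials_def)
  finally show ?thesis .
qed

section \<open>Minimal monomials and uniqueness of G(I)\<close>

definition minimal_monoms :: "'v monom set \<Rightarrow> 'v monom set" where
  "minimal_monoms U = {u \<in> U. \<forall>w\<in>U. monom_dvd w u \<longrightarrow> w = u}"

text \<open>Descent on the total degree: a monomial of \<open>U\<close> that is not minimal has a
  different divisor in \<open>U\<close>, whose total degree is strictly smaller.\<close>

lemma minimal_monoms_below:
  fixes U :: "'v::finite monom set"
  assumes "u \<in> U"
  shows "\<exists>w\<in>minimal_monoms U. monom_dvd w u"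
  using assms
proof (induction "\<Sum>i\<in>UNIV. Poly_Mapping.lookup u i" arbitrary: u rule: less_induct)
  case less
  show ?case
  proof (cases "u \<in> minimal_monoms U")
    case True
    then show ?thesis using monom_dvd_refl by blast
  next
    case False
    then obtain w where w: "w \<in> U" "monom_dvd w u" "w \<noteq> u"
      using less.prems by (auto simp: minimal_monoms_def)
    obtain i where "Poly_Mapping.lookup w i \<noteq> Poly_Mapping.lookup u i"
      using w(3) by (metis poly_mapping_eqI)
    then have "(\<Sum>i\<in>UNIV. Poly_Mapping.lookup w i) < (\<Sum>i\<in>UNIV. Poly_Mapping.lookup u i)"
      using w(2) unfolding monom_dvd_iff by (intro sum_strict_mono_ex1) (auto simp: order_less_le)
    from less.hyps[OF this w(1)] show ?thesis
      using w(2) monom_dvd_trans by blast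
  qed
qed

text \<open>The minimal monomials generate the ideal because each element of \<open>U\<close> lies
  above one. They also lie in every monomial generating set \<open>H\<close>: if \<open>u\<close> is
  minimal, some \<open>h\<close> in \<open>H\<close> divides \<open>u\<close> and some
  \<open>w\<close> in \<open>U\<close> divides \<open>h\<close>, whence \<open>w = u = h\<close>. So
  the description in \<open>min_gens\<close> has exactly one solution.\<close>

lemma min_monomial_gens_iff:
  "min_monomial_gens (ideal_gen (monomials U :: ('v::finite, 'k::field) mpoly set)) G
     \<longleftrightarrow> G = minimal_monoms U"
proof -
  let ?I = "\<lambda>U. ideal_gen (monomials U :: ('v, 'k) mpoly set)"
  have eq: "?I (minimal_monoms U) = ?I U"
    using minimal_monoms_below[of _ U]
    by (intro equalityI) (auto simp: ideal_gen_monomials_subset_iff minimal_monoms_def intro: monom_dvd_refl)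
  have sub: "minimal_monoms U \<subseteq> H" if "?I H = ?I U" for H
  proof
    fix u assume u: "u \<in> minimal_monoms U"
    have "\<forall>u\<in>U. \<exists>h\<in>H. monom_dvd h u" "\<forall>h\<in>H. \<exists>w\<in>U. monom_dvd w h"
      using that ideal_gen_monomials_subset_iff[where 'k='k] by blast+
    then obtain h w where h: "h \<in> H" "monom_dvd h u" and w: "w \<in> U" "monom_dvd w h"
      using u unfolding minimal_monoms_def by blast
    have "w = u"
      using u w monom_dvd_trans[OF w(2) h(2)] by (auto simp: minimal_monoms_def)
    with w(2) h(2) have "h = u"
      by (intro poly_mapping_eqI antisym) (auto simp: monom_dvd_iff)
    with h(1) show "u \<in> H" by simp
  qed
  show ?thesis
    unfolding min_monomial_gens_def using eq sub by blast
qed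

lemma min_gens_ideal_gen:
  "min_gens (ideal_gen (monomials U :: ('v::finite, 'k::field) mpoly set)) = minimal_monoms U"
  unfolding min_gens_def min_monomial_gens_iff by simp

lemma ideal_gen_min_gens:
  assumes "monomial_ideal I"
  shows "ideal_gen (monomials (min_gens I)) = I"
  using assms min_monomial_gens_iff min_gens_ideal_gen
  unfolding monomial_ideal_def min_monomial_gens_def by metis

text \<open>Dominant sets are antichains: a divisor \<open>w\<close> of \<open>u\<close> with
  \<open>w \<noteq> u\<close> would exceed \<open>u\<close> in the variable where \<open>w\<close>
  is dominant.\<close>

lemma minimal_monoms_dominant_set: "dominant_set L \<Longrightarrow> minimal_monoms L = L"
  unfolding minimal_monoms_def dominant_set_def dominant_in_def monom_dvd_iff
  by (force simp: not_less[symmetric])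

text \<open>Removes the field from the count. Nonzero ideals match nonempty sets, since the empty
  set spans only 0 while any monomial in \<open>L\<close> is a nonzero element of the ideal.\<close>

lemma dominant_ideals_bij:
  "bij_betw min_gens
     {I :: ('v::finite, 'k::field) mpoly set. dominant_ideal I \<and> ideal_has_lcm I M}
     {L. dominant_set L \<and> L \<noteq> {} \<and> is_lcm_of M L}"
proof (rule bij_betw_byWitness[where f' = "\<lambda>L. ideal_gen (monomials L)"])
  show "\<forall>I\<in>{I :: ('v, 'k) mpoly set. dominant_ideal I \<and> ideal_has_lcm I M}.
      ideal_gen (monomials (min_gens I)) = I"
    by (simp add: dominant_ideal_def ideal_gen_min_gens)
  show "\<forall>L\<in>{L. dominant_set L \<and> L \<noteq> {} \<and> is_lcm_of M L}.
      min_gens (ideal_gen (monomials L :: ('v, 'k) mpoly set)) = L"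
    by (simp add: min_gens_ideal_gen minimal_monoms_dominant_set)
  have "min_gens I \<noteq> {}" if "monomial_ideal I" "I \<noteq> {0}" for I :: "('v, 'k) mpoly set"
    using ideal_gen_min_gens[OF that(1)] that(2) by (auto simp: monomials_def)
  then show "min_gens ` {I :: ('v, 'k) mpoly set. dominant_ideal I \<and> ideal_has_lcm I M}
      \<subseteq> {L. dominant_set L \<and> L \<noteq> {} \<and> is_lcm_of M L}"
    by (auto simp: dominant_ideal_def ideal_has_lcm_def)
  have "ideal_gen (monomials L :: ('v, 'k) mpoly set) \<noteq> {0}" if "L \<noteq> {}" for L
  proof -
    from that obtain u where "u \<in> L" by blast
    then have "Poly_Mapping.single u 1 \<in> ideal_gen (monomials L :: ('v, 'k) mpoly set)"
      using single_in_ideal_gen_monomials_iff monom_dvd_refl by blast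
    moreover have "Poly_Mapping.single u (1::'k) \<noteq> 0"
      by (metis lookup_single_eq lookup_zero zero_neq_one)
    ultimately show ?thesis by blast
  qed
  then show "(\<lambda>L. ideal_gen (monomials L)) ` {L. dominant_set L \<and> L \<noteq> {} \<and> is_lcm_of M L}
      \<subseteq> {I :: ('v, 'k) mpoly set. dominant_ideal I \<and> ideal_has_lcm I M}"
    by (auto simp: dominant_ideal_def ideal_has_lcm_def min_gens_ideal_gen
        minimal_monoms_dominant_set monomial_ideal_def)
qed

subsection \<open>Counting dominant sets\<close>

text \<open>Choosing a dominating variable for each element is injective: two elements sharing one
  would each strictly exceed the other there.\<close>

lemma card_dominant_set_le:
  fixes L :: "'v::finite monom set"
  assumes "dominant_set L"
  shows "card L \<le> CARD('v)"
proof -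
  from assms obtain p where p:
    "\<And>v w. v \<in> L \<Longrightarrow> w \<in> L - {v} \<Longrightarrow> Poly_Mapping.lookup w (p v) < Poly_Mapping.lookup v (p v)"
    unfolding dominant_set_def dominant_in_def by metis
  have "inj_on p L"
    using p by (intro inj_onI) (metis DiffI less_asym singletonD)
  then show ?thesis
    by (rule card_inj_on_le) auto
qed

text \<open>Turns the universal property into a condition on each variable separately: the exponent
  in the lcm is the attained maximum.\<close>

lemma is_lcm_of_iff:
  fixes L :: "'v::finite monom set"
  assumes "L \<noteq> {}"
  shows "is_lcm_of M L \<longleftrightarrow>
    (\<forall>i. (\<forall>u\<in>L. Poly_Mapping.lookup u i \<le> Poly_Mapping.lookup M i) \<and>
         (\<exists>u\<in>L. Poly_Mapping.lookup u i = Poly_Mapping.lookup M i))"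
proof (intro iffI allI conjI)
  fix i
  assume lcm: "is_lcm_of M L"
  then show le: "\<forall>u\<in>L. Poly_Mapping.lookup u i \<le> Poly_Mapping.lookup M i"
    by (auto simp: is_lcm_of_def monom_dvd_iff)
  show "\<exists>u\<in>L. Poly_Mapping.lookup u i = Poly_Mapping.lookup M i"
  proof (rule ccontr)
    assume "\<not> ?thesis"
    then have less: "\<forall>u\<in>L. Poly_Mapping.lookup u i < Poly_Mapping.lookup M i"
      using le by (auto simp: order_less_le)
    \<comment> \<open>If the bound is not attained in variable \<open>i\<close>, one factor of that
      variable can be removed from \<open>M\<close>, leaving a smaller common multiple.\<close>
    have "monom_dvd M (M - Poly_Mapping.single i 1)"
    proof -
      have "\<forall>u\<in>L. monom_dvd u (M - Poly_Mapping.single i 1)"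
        using lcm less
        by (fastforce simp: is_lcm_of_def monom_dvd_iff lookup_minus lookup_single when_def)
      with lcm show ?thesis by (simp add: is_lcm_of_def)
    qed
    then have "Poly_Mapping.lookup M i \<le> Poly_Mapping.lookup M i - 1"
      unfolding monom_dvd_iff by (metis lookup_minus lookup_single_eq)
    \<comment> \<open>The subtraction truncates, so the contradiction needs a positive exponent; an
      element of the nonempty \<open>L\<close> lies strictly below it.\<close>
    with less assms show False by fastforce
  qed
next
  assume "\<forall>i. (\<forall>u\<in>L. Poly_Mapping.lookup u i \<le> Poly_Mapping.lookup M i) \<and>
         (\<exists>u\<in>L. Poly_Mapping.lookup u i = Poly_Mapping.lookup M i)"
  then show "is_lcm_of M L"
    unfolding is_lcm_of_def monom_dvd_iff by metis
qed

section \<open>Columns, peaks and inclusion-exclusion\<close>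

definition columns :: "nat \<Rightarrow> nat \<Rightarrow> (nat \<Rightarrow> nat) set" where
  "columns q a = {f \<in> {..<q} \<rightarrow>\<^sub>E {..a}. \<exists>j<q. f j = a}"

text \<open>Row \<open>j\<close> carries the strict maximum of the column; with a single row this
  holds vacuously.\<close>

definition peak :: "nat \<Rightarrow> (nat \<Rightarrow> nat) \<Rightarrow> nat \<Rightarrow> bool" where
  "peak q f j \<longleftrightarrow> (\<forall>k<q. k \<noteq> j \<longrightarrow> f k < f j)"

text \<open>A matrix assigns to each variable the column of its exponents in \<open>q\<close> enumerated generators.\<close>

definition peak_matrices :: "('v::finite \<Rightarrow> nat) \<Rightarrow> nat \<Rightarrow> ('v \<Rightarrow> nat \<Rightarrow> nat) set" where
  "peak_matrices m q = {c. (\<forall>i. c i \<in> columns q (m i)) \<and> (\<forall>j<q. \<exists>i. peak q (c i) j)}"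

lemma finite_columns: "finite (columns q a)"
  unfolding columns_def by (rule finite_subset[of _ "{..<q} \<rightarrow>\<^sub>E {..a}"]) (auto intro: finite_PiE)

text \<open>Among all columns bounded by \<open>a\<close>, those missing the value \<open>a\<close>
  are the ones bounded strictly by \<open>a\<close>.\<close>

lemma card_columns: "card (columns q a) = (a + 1) ^ q - a ^ q"
proof -
  have "columns q a = ({..<q} \<rightarrow>\<^sub>E {..a}) - ({..<q} \<rightarrow>\<^sub>E {..<a})"
  proof (rule set_eqI)
    fix f
    show "f \<in> columns q a \<longleftrightarrow> f \<in> ({..<q} \<rightarrow>\<^sub>E {..a}) - ({..<q} \<rightarrow>\<^sub>E {..<a})"
      unfolding columns_def Diff_iff mem_Collect_eq PiE_iff Ball_def lessThan_iff atMost_iff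
      by (meson le_neq_implies_less less_irrefl)
  qed
  moreover have "({..<q} \<rightarrow>\<^sub>E {..<a}) \<subseteq> ({..<q} \<rightarrow>\<^sub>E {..a})"
    by (intro PiE_mono) auto
  ultimately show ?thesis
    by (simp add: card_Diff_subset finite_PiE card_PiE)
qed

text \<open>A peak must carry the attained maximum \<open>a\<close>, and each other row is free
  among the \<open>a\<close> smaller values. For \<open>a = 0\<close> and \<open>q = 1\<close> the
  convention \<open>0 ^ 0 = 1\<close> counts the one constant column correctly.\<close>

lemma card_columns_peak:
  assumes "j < q"
  shows "card {f \<in> columns q a. peak q f j} = a ^ (q - 1)"
proof -
  have "{f \<in> columns q a. peak q f j} = PiE {..<q} (\<lambda>k. if k = j then {a} else {..<a})" (is "?A = ?B")
  proof
    show "?A \<subseteq> ?B"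
    proof
      fix f assume f: "f \<in> ?A"
      then obtain l where l: "l < q" "f l = a" by (auto simp: columns_def)
      have le: "f k \<le> a" if "k < q" for k
        using f that by (auto simp: columns_def PiE_iff)
      have "f j = a"
        using f l le[OF assms] by (cases "l = j") (auto simp: peak_def)
      with f show "f \<in> ?B"
        by (auto simp: columns_def peak_def PiE_iff)
    qed
    show "?B \<subseteq> ?A"
    proof
      fix f assume "f \<in> ?B"
      then have ext: "f \<in> extensional {..<q}"
        and B: "\<And>k. k < q \<Longrightarrow> f k \<in> (if k = j then {a} else {..<a})"
        by (simp_all add: PiE_iff)
      have less: "f k < a" if "k < q" "k \<noteq> j" for k
        using B[OF that(1)] that(2) by simp
      have "f j = a" using B[OF assms] by simp
      moreover have "f k \<le> a" if "k < q" for k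
        using less[OF that] \<open>f j = a\<close> by (cases "k = j") auto
      ultimately show "f \<in> ?A"
        using assms ext less by (auto simp: columns_def peak_def PiE_iff)
    qed
  qed
  moreover have "(\<Prod>k<q. card (if k = j then {a} else {..<a})) = (\<Prod>k\<in>{..<q}-{j}. a)"
    using assms by (subst prod.remove[of _ j]) auto
  ultimately show ?thesis
    using assms by (simp add: card_PiE)
qed

lemma peak_unique: "peak q f j \<Longrightarrow> peak q f k \<Longrightarrow> j < q \<Longrightarrow> k < q \<Longrightarrow> j = k"
  unfolding peak_def by (metis less_asym)

text \<open>A column has at most one peak, so the columns peaking at the various rows of
  \<open>T\<close> form disjoint sets and their numbers are simply subtracted.\<close>

lemma card_columns_avoiding:
  assumes "T \<subseteq> {..<q}"
  shows "int (card {f \<in> columns q a. \<forall>j\<in>T. \<not> peak q f j})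
    = int (a + 1) ^ q - int a ^ q - int (card T) * int a ^ (q - 1)"
proof -
  let ?P = "\<lambda>j. {f \<in> columns q a. peak q f j}"
  have "card (\<Union>j\<in>T. ?P j) = (\<Sum>j\<in>T. card (?P j))"
    using assms finite_subset[OF assms]
    by (intro card_UN_disjoint) (auto simp: finite_columns dest: peak_unique)
  also have "\<dots> = card T * a ^ (q - 1)"
    using assms by (subst sum.cong[OF refl card_columns_peak]) auto
  finally have U: "card (\<Union>j\<in>T. ?P j) = card T * a ^ (q - 1)" .
  have "{f \<in> columns q a. \<forall>j\<in>T. \<not> peak q f j} = columns q a - (\<Union>j\<in>T. ?P j)"
    by auto
  moreover have sub: "(\<Union>j\<in>T. ?P j) \<subseteq> columns q a" by auto
  moreover have "int (card (columns q a)) = int (a + 1) ^ q - int a ^ q"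
    by (simp add: card_columns of_nat_diff power_mono)
  ultimately show ?thesis
    using U card_mono[OF finite_columns sub]
    by (simp add: card_Diff_subset finite_subset[OF sub finite_columns] of_nat_diff)
qed

text \<open>Inclusion-exclusion over the sets \<open>T\<close> of rows that are a peak of no
  column.\<close>

lemma card_peak_matrices:
  fixes m :: "'v::finite \<Rightarrow> nat"
  shows "int (card (peak_matrices m q)) =
    (\<Sum>t\<le>q. (-1) ^ t * int (q choose t) *
      (\<Prod>i\<in>UNIV. int (m i + 1) ^ q - int (m i) ^ q - int t * int (m i) ^ (q - 1)))"
proof -
  define C where "C = PiE UNIV (\<lambda>i. columns q (m i))"
  have finC: "finite C"
    unfolding C_def by (intro finite_PiE) (auto simp: finite_columns)
  let ?N = "\<lambda>c j. \<forall>i. \<not> peak q (c i) j"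
  let ?F = "\<lambda>t. (\<Prod>i\<in>UNIV. int (m i + 1) ^ q - int (m i) ^ q - int t * int (m i) ^ (q - 1))"
  \<comment> \<open>Having no peak in \<open>T\<close> is a condition on each column separately, so
    the count is a product over the variables.\<close>
  have avoid: "(\<Sum>c\<in>C. of_bool (\<forall>j\<in>T. ?N c j)) = ?F (card T)" if "T \<subseteq> {..<q}" for T
  proof -
    have "C \<inter> {c. \<forall>j\<in>T. ?N c j} = PiE UNIV (\<lambda>i. {f \<in> columns q (m i). \<forall>j\<in>T. \<not> peak q f j})"
      unfolding C_def by (auto simp: PiE_UNIV_domain Pi_iff)
    then have "(\<Sum>c\<in>C. of_bool (\<forall>j\<in>T. ?N c j))
        = int (card (PiE UNIV (\<lambda>i. {f \<in> columns q (m i). \<forall>j\<in>T. \<not> peak q f j})))"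
      using finC by simp
    also have "\<dots> = ?F (card T)"
      by (simp only: card_PiE finite_class.finite_UNIV of_nat_prod card_columns_avoiding[OF that])
    finally show ?thesis .
  qed
  have "peak_matrices m q = C \<inter> {c. \<forall>j<q. \<not> ?N c j}"
    unfolding peak_matrices_def C_def by (auto simp: PiE_UNIV_domain Pi_iff)
  then have "int (card (peak_matrices m q)) = (\<Sum>c\<in>C. of_bool (\<forall>j\<in>{..<q}. \<not> ?N c j))"
    using finC by (simp add: Ball_def)
  \<comment> \<open>The indicator that every row is a peak somewhere is a product of factors 1 minus
    the indicator of a bad row; expanding it gives the signed sum over \<open>T\<close>.\<close>
  also have "\<dots> = (\<Sum>c\<in>C. \<Prod>j<q. - of_bool (?N c j) + 1)"
    by (intro sum.cong refl) (auto simp: prod_zero_iff intro!: prod.neutral)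
  also have "\<dots> = (\<Sum>c\<in>C. \<Sum>T\<in>Pow {..<q}. (-1) ^ card T * of_bool (\<forall>j\<in>T. ?N c j))"
  proof (intro sum.cong refl)
    fix c
    have N: "(\<Prod>j\<in>T. of_bool (?N c j)) = (of_bool (\<forall>j\<in>T. ?N c j) :: int)" if "finite T" for T
      using that by induction auto
    have "(\<Prod>j<q. - of_bool (?N c j) + 1)
        = (\<Sum>T\<in>Pow {..<q}. (\<Prod>j\<in>T. - of_bool (?N c j)) * (\<Prod>j\<in>{..<q}-T. 1) :: int)"
      by (rule prod_add) simp
    also have "\<dots> = (\<Sum>T\<in>Pow {..<q}. (-1) ^ card T * of_bool (\<forall>j\<in>T. ?N c j))"
    proof (intro sum.cong refl)
      fix T assume "T \<in> Pow {..<q}"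
      then have "finite T" using finite_subset by blast
      from N[OF this] show "(\<Prod>j\<in>T. - of_bool (?N c j)) * (\<Prod>j\<in>{..<q}-T. 1)
          = ((-1) ^ card T * of_bool (\<forall>j\<in>T. ?N c j) :: int)"
        by (simp only: prod_uminus prod.neutral_const mult_1_right)
    qed
    finally show "(\<Prod>j<q. - of_bool (?N c j) + 1)
        = (\<Sum>T\<in>Pow {..<q}. (-1) ^ card T * of_bool (\<forall>j\<in>T. ?N c j) :: int)" .
  qed
  also have "\<dots> = (\<Sum>T\<in>Pow {..<q}. \<Sum>c\<in>C. (-1) ^ card T * of_bool (\<forall>j\<in>T. ?N c j))"
    by (rule sum.swap)
  also have "\<dots> = (\<Sum>T\<in>Pow {..<q}. (-1) ^ card T * ?F (card T))"
    by (intro sum.cong refl) (simp only: sum_distrib_left[symmetric] Pow_iff avoid)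
  \<comment> \<open>The summand depends only on the size of \<open>T\<close>, so the subsets are
    grouped by size, giving the binomial coefficients.\<close>
  also have "\<dots> = (\<Sum>t\<le>q. \<Sum>T | T \<in> Pow {..<q} \<and> card T = t. (-1) ^ card T * ?F (card T))"
    by (rule sum.group[symmetric]) (auto dest: card_mono[OF finite_lessThan])
  also have "\<dots> = (\<Sum>t\<le>q. (-1) ^ t * int (q choose t) * ?F t)"
  proof (intro sum.cong refl)
    fix t
    have "int (card {T. T \<subseteq> {..<q} \<and> card T = t}) = int (q choose t)"
      using n_subsets[of "{..<q}" t] by simp
    moreover have "(\<Sum>T | T \<in> Pow {..<q} \<and> card T = t. (-1) ^ card T * ?F (card T))
        = (\<Sum>T | T \<in> Pow {..<q} \<and> card T = t. (-1) ^ t * ?F t)"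
      by (intro sum.cong) auto
    moreover have "\<dots> = int (card {T. T \<subseteq> {..<q} \<and> card T = t}) * ((-1) ^ t * ?F t)"
      by simp
    ultimately show "(\<Sum>T | T \<in> Pow {..<q} \<and> card T = t. (-1) ^ card T * ?F (card T))
        = (-1) ^ t * int (q choose t) * ?F t"
      by (simp only: mult_ac)
  qed
  finally show ?thesis .
qed


section \<open>Dominant sets as lists and matrices\<close>

lemma finite_dominant_sets:
  "finite {L :: 'v::finite monom set. dominant_set L \<and> L \<noteq> {} \<and> is_lcm_of M L}"
proof (rule finite_subset)
  show "{L. dominant_set L \<and> L \<noteq> {} \<and> is_lcm_of M L} \<subseteq> Pow {u. monom_dvd u M}"
    by (auto simp: is_lcm_of_def)
  have "finite (PiE UNIV (\<lambda>i. {..Poly_Mapping.lookup M i}))"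
    by (intro finite_PiE) auto
  moreover have "Poly_Mapping.lookup ` {u. monom_dvd u M} \<subseteq> PiE UNIV (\<lambda>i. {..Poly_Mapping.lookup M i})"
    by (auto simp: monom_dvd_iff)
  ultimately have "finite (Poly_Mapping.lookup ` {u. monom_dvd u M})"
    by (rule rev_finite_subset)
  moreover have "inj_on Poly_Mapping.lookup {u. monom_dvd u M}"
    by (simp add: inj_on_def lookup_inject)
  ultimately show "finite (Pow {u. monom_dvd u M})"
    by (simp add: finite_image_iff)
qed

text \<open>The variable comes first and the list position second, so that partial application
  yields a column; the restriction makes columns extensional, as in \<open>columns\<close>.\<close>

definition exponent_matrix :: "'v monom list \<Rightarrow> 'v \<Rightarrow> nat \<Rightarrow> nat" where
  "exponent_matrix xs i = (\<lambda>j\<in>{..<length xs}. Poly_Mapping.lookup (xs ! j) i)"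

text \<open>Reading a matrix by rows recovers the monomials; with finitely many variables every row
  of exponents has finite support, so \<open>Abs_poly_mapping\<close> loses nothing.\<close>

lemma exponent_matrix_bij:
  "bij_betw exponent_matrix {xs :: 'v::finite monom list. length xs = q} {c. \<forall>i. c i \<in> extensional {..<q}}"
proof (rule bij_betw_byWitness[where f' = "\<lambda>c. map (\<lambda>j. Abs_poly_mapping (\<lambda>i. c i j)) [0..<q]"])
  show "\<forall>xs\<in>{xs. length xs = q}.
      map (\<lambda>j. Abs_poly_mapping (\<lambda>i. exponent_matrix xs i j)) [0..<q] = (xs :: 'v monom list)"
    by (auto simp: exponent_matrix_def lookup_inverse intro!: nth_equalityI)
  show "\<forall>c\<in>{c. \<forall>i. c i \<in> extensional {..<q}}.
      exponent_matrix (map (\<lambda>j. Abs_poly_mapping (\<lambda>i. c i j)) [0..<q]) = (c :: 'v \<Rightarrow> nat \<Rightarrow> nat)"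
    by (auto simp: exponent_matrix_def extensional_def restrict_def fun_eq_iff)
qed (auto simp: exponent_matrix_def)

text \<open>Membership of the columns in \<open>columns\<close> encodes the lcm, and a peak in every
  row encodes dominance together with distinctness.\<close>

lemma exponent_matrix_in_peak_matrices_iff:
  fixes M :: "'v::finite monom"
  assumes "xs \<noteq> []"
  shows "exponent_matrix xs \<in> peak_matrices (Poly_Mapping.lookup M) (length xs)
    \<longleftrightarrow> distinct xs \<and> dominant_set (set xs) \<and> is_lcm_of M (set xs)"
proof -
  let ?q = "length xs"
  have col: "exponent_matrix xs i \<in> columns ?q a \<longleftrightarrow>
      (\<forall>u\<in>set xs. Poly_Mapping.lookup u i \<le> a) \<and> (\<exists>u\<in>set xs. Poly_Mapping.lookup u i = a)" for i a
    by (auto simp: columns_def exponent_matrix_def PiE_iff all_set_conv_all_nth in_set_conv_nth Bex_def)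
  have "set xs \<noteq> {}" using assms by simp
  then have lcm: "is_lcm_of M (set xs) \<longleftrightarrow>
      (\<forall>i. exponent_matrix xs i \<in> columns ?q (Poly_Mapping.lookup M i))"
    unfolding col by (rule is_lcm_of_iff)
  have peak: "peak ?q (exponent_matrix xs i) j \<longleftrightarrow>
      (\<forall>k<?q. k \<noteq> j \<longrightarrow> Poly_Mapping.lookup (xs ! k) i < Poly_Mapping.lookup (xs ! j) i)"
    if "j < ?q" for i j
    using that by (auto simp: peak_def exponent_matrix_def)
  have "(\<forall>j<?q. \<exists>i. peak ?q (exponent_matrix xs i) j) \<longleftrightarrow> distinct xs \<and> dominant_set (set xs)"
  proof safe
    assume *: "\<forall>j<?q. \<exists>i. peak ?q (exponent_matrix xs i) j"
    \<comment> \<open>Two equal rows would rule out a strict maximum in either of them.\<close>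
    show "distinct xs"
      unfolding distinct_conv_nth using * peak by (metis less_irrefl)
    show "dominant_set (set xs)"
      unfolding dominant_set_def dominant_in_def
    proof (intro conjI ballI)
      fix v assume "v \<in> set xs"
      then obtain j where j: "j < ?q" "v = xs ! j" by (auto simp: in_set_conv_nth)
      with * obtain i where "peak ?q (exponent_matrix xs i) j" by blast
      then have i: "\<forall>k<?q. k \<noteq> j \<longrightarrow> Poly_Mapping.lookup (xs ! k) i < Poly_Mapping.lookup v i"
        using j by (simp add: peak)
      have "Poly_Mapping.lookup w i < Poly_Mapping.lookup v i" if w: "w \<in> set xs - {v}" for w
      proof -
        from w obtain k where "k < ?q" "w = xs ! k" by (auto simp: in_set_conv_nth)
        with w i j(2) show ?thesis by auto
      qed
      then show "\<exists>i. \<forall>w\<in>set xs - {v}. Poly_Mapping.lookup w i < Poly_Mapping.lookup v i"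
        by blast
    qed auto
  next
    fix j assume "distinct xs" "dominant_set (set xs)" "j < ?q"
    then obtain i where
      "\<forall>w\<in>set xs - {xs ! j}. Poly_Mapping.lookup w i < Poly_Mapping.lookup (xs ! j) i"
      unfolding dominant_set_def dominant_in_def by (meson nth_mem)
    \<comment> \<open>Dominance compares with other monomials, a peak with other positions;
      distinctness identifies the two.\<close>
    with \<open>distinct xs\<close> \<open>j < ?q\<close> have "peak ?q (exponent_matrix xs i) j"
      by (auto simp: peak nth_eq_iff_index_eq)
    then show "\<exists>i. peak ?q (exponent_matrix xs i) j" ..
  qed
  with lcm show ?thesis
    unfolding peak_matrices_def by blast
qed

text \<open>Each set of size \<open>q\<close> has \<open>fact q\<close> enumerations, different sets
  have disjoint families of enumerations, and the exponent matrix determines the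
  enumeration.\<close>

lemma card_dominant_sets_of_card:
  fixes M :: "'v::finite monom"
  assumes "q > 0"
  shows "fact q * card {L. dominant_set L \<and> is_lcm_of M L \<and> card L = q}
    = card (peak_matrices (Poly_Mapping.lookup M) q)"
proof -
  let ?D = "{L. dominant_set L \<and> is_lcm_of M L \<and> card L = q}"
  have "?D \<subseteq> {L. dominant_set L \<and> L \<noteq> {} \<and> is_lcm_of M L}"
    using assms by auto
  then have "finite ?D"
    using finite_dominant_sets finite_subset by blast
  then have "card (\<Union>L\<in>?D. permutations_of_set L) = (\<Sum>L\<in>?D. card (permutations_of_set L))"
    by (intro card_UN_disjoint) (auto dest: permutations_of_setD)
  also have "\<dots> = fact q * card ?D"
    by (simp add: dominant_set_def)
  finally have perms: "card (\<Union>L\<in>?D. permutations_of_set L) = fact q * card ?D" .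
  have "exponent_matrix ` (\<Union>L\<in>?D. permutations_of_set L) = peak_matrices (Poly_Mapping.lookup M) q"
  proof (intro equalityI subsetI)
    fix c assume "c \<in> exponent_matrix ` (\<Union>L\<in>?D. permutations_of_set L)"
    then obtain xs where "c = exponent_matrix xs" "dominant_set (set xs)" "is_lcm_of M (set xs)"
      "distinct xs" "length xs = q"
      by (auto simp: permutations_of_set_def distinct_card)
    then show "c \<in> peak_matrices (Poly_Mapping.lookup M) q"
      using assms exponent_matrix_in_peak_matrices_iff[of xs M] by auto
  next
    fix c assume c: "c \<in> peak_matrices (Poly_Mapping.lookup M) q"
    then have "\<forall>i. c i \<in> extensional {..<q}"
      by (auto simp: peak_matrices_def columns_def PiE_iff)
    then obtain xs where xs: "length xs = q" "c = exponent_matrix xs"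
      using exponent_matrix_bij[of q, where 'v='v] unfolding bij_betw_def by blast
    then show "c \<in> exponent_matrix ` (\<Union>L\<in>?D. permutations_of_set L)"
      using assms c exponent_matrix_in_peak_matrices_iff[of xs M]
      by (auto simp: permutations_of_set_def distinct_card)
  qed
  moreover have "inj_on exponent_matrix (\<Union>L\<in>?D. permutations_of_set L)"
    using exponent_matrix_bij[of q, where 'v='v]
    by (auto simp: bij_betw_def permutations_of_set_def distinct_card elim!: inj_on_subset)
  then have "card (exponent_matrix ` (\<Union>L\<in>?D. permutations_of_set L))
      = card (\<Union>L\<in>?D. permutations_of_set L)"
    by (rule card_image)
  ultimately show ?thesis
    by (simp only: perms)
qed

text \<open>Splits the count by the number of generators, which is positive because the ideal is
  nonzero and bounded by the number of variables because of dominance.\<close>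

lemma card_dominant_ideals:
  "card {I :: ('v::finite, 'k::field) mpoly set. dominant_ideal I \<and> ideal_has_lcm I M}
    = (\<Sum>q=1..CARD('v). card {L. dominant_set L \<and> is_lcm_of M L \<and> card L = q})"
proof -
  let ?D = "{L. dominant_set L \<and> L \<noteq> {} \<and> is_lcm_of M L}"
  have "card {I :: ('v, 'k) mpoly set. dominant_ideal I \<and> ideal_has_lcm I M} = card ?D"
    by (rule bij_betw_same_card[OF dominant_ideals_bij])
  also have "\<dots> = (\<Sum>q=1..CARD('v). card {L \<in> ?D. card L = q})"
  proof -
    have "card ` ?D \<subseteq> {1..CARD('v)}"
      by (auto simp: card_dominant_set_le Suc_le_eq card_gt_0_iff dominant_set_def[of "_ :: 'v monom set"])
    from sum.group[OF finite_dominant_sets finite_atLeastAtMost this, of "\<lambda>_. 1 :: nat"]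
    show ?thesis by simp
  qed
  also have "\<dots> = (\<Sum>q=1..CARD('v). card {L. dominant_set L \<and> is_lcm_of M L \<and> card L = q})"
    by (intro sum.cong refl arg_cong[where f = card]) auto
  finally show ?thesis .
qed

lemma lookup_monom_of: "Poly_Mapping.lookup (monom_of m) = m"
  by (rule ext) (simp add: monom_of_def lookup_sum lookup_single when_def)

subsection \<open>Five variables\<close>

lemma UNIV_5: "(UNIV :: 5 set) = {0,1,2,3,4}"
proof -
  have "x \<in> {0,1,2,3,4}" for x :: 5
  proof (cases x)
    case (of_int z)
    then have "z = 0 \<or> z = 1 \<or> z = 2 \<or> z = 3 \<or> z = 4" by auto
    with of_int(1) show ?thesis by auto
  qed
  then show ?thesis by blast
qed

lemma greaterThan_5:
  "{0 :: 5<..} = {1, 2, 3, 4}" "{1 :: 5<..} = {2, 3, 4}" "{2 :: 5<..} = {3, 4}"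
  "{3 :: 5<..} = {4}" "{4 :: 5<..} = {}"
proof -
  have filter_insert: "{x \<in> insert y A. P x} = (if P y then insert y {x \<in> A. P x} else {x \<in> A. P x})"
    for y and A :: "5 set" and P by auto
  have gt: "{a<..} = {x \<in> {0, 1, 2, 3, 4}. a < x}" for a :: 5
    unfolding UNIV_5[symmetric] by auto
  show
    "{0 :: 5<..} = {1, 2, 3, 4}" "{1 :: 5<..} = {2, 3, 4}" "{2 :: 5<..} = {3, 4}"
    "{3 :: 5<..} = {4}" "{4 :: 5<..} = {}"
    \<comment> \<open>The order on the numeral type is that of the integer representatives, so each
      comparison becomes one between integer numerals.\<close>
    unfolding gt filter_insert less_bit1_def bit1.Rep_0 bit1.Rep_1 bit1.Rep_numeral by simp_all
qed

text \<open>The pairs are listed by first index; triples and quadruples then extend such a list by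
  one larger last index.\<close>

lemma increasing_pairs_5: "{(i, j) |i j :: 5. i < j} =
  {(0, 1), (0, 2), (0, 3), (0, 4), (1, 2), (1, 3), (1, 4), (2, 3), (2, 4), (3, 4)}"
proof -
  have "{(i, j) |i j :: 5. i < j} = (\<Union>i\<in>UNIV. (\<lambda>j. (i, j)) ` {i<..})"
    by auto
  then show ?thesis
    by (simp add: UNIV_5 greaterThan_5 insert_commute)
qed

lemma increasing_triples_5: "{(i, j, k) |i j k :: 5. i < j \<and> j < k} =
  {(0, 1, 2), (0, 1, 3), (0, 1, 4), (0, 2, 3), (0, 2, 4), (0, 3, 4), (1, 2, 3), (1, 2, 4), (1, 3, 4), (2, 3, 4)}"
proof -
  have "{(i, j, k) |i j k :: 5. i < j \<and> j < k}
      = (\<Union>(i, j)\<in>{(i, j) |i j. i < j}. (\<lambda>k. (i, j, k)) ` {j<..})"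
    by auto
  then show ?thesis
    unfolding increasing_pairs_5 by (simp add: greaterThan_5 insert_commute)
qed

lemma increasing_quadruples_5: "{(i, j, k, l) |i j k l :: 5. i < j \<and> j < k \<and> k < l} =
  {(0, 1, 2, 3), (0, 1, 2, 4), (0, 1, 3, 4), (0, 2, 3, 4), (1, 2, 3, 4)}"
proof -
  have "{(i, j, k, l) |i j k l :: 5. i < j \<and> j < k \<and> k < l}
      = (\<Union>(i, j, k)\<in>{(i, j, k) |i j k. i < j \<and> j < k}. (\<lambda>l. (i, j, k, l)) ` {k<..})"
    by auto
  then show ?thesis
    unfolding increasing_triples_5 by (simp add: greaterThan_5 insert_commute)
qed

lemma neq_5:
  "(0 :: 5) \<noteq> 1" "(0 :: 5) \<noteq> 2" "(0 :: 5) \<noteq> 3" "(0 :: 5) \<noteq> 4"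
  "(1 :: 5) \<noteq> 0" "(1 :: 5) \<noteq> 2" "(1 :: 5) \<noteq> 3" "(1 :: 5) \<noteq> 4"
  "(2 :: 5) \<noteq> 0" "(2 :: 5) \<noteq> 1" "(2 :: 5) \<noteq> 3" "(2 :: 5) \<noteq> 4"
  "(3 :: 5) \<noteq> 0" "(3 :: 5) \<noteq> 1" "(3 :: 5) \<noteq> 2" "(3 :: 5) \<noteq> 4"
  "(4 :: 5) \<noteq> 0" "(4 :: 5) \<noteq> 1" "(4 :: 5) \<noteq> 2" "(4 :: 5) \<noteq> 3"
  unfolding bit1.Rep_inject_sym bit1.Rep_0 bit1.Rep_1 bit1.Rep_numeral by simp_all

lemma prod_UNIV_5: "(\<Prod>i\<in>UNIV. f i) = f 0 * f 1 * f 2 * f 3 * f (4 :: 5)"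
  for f :: "5 \<Rightarrow> 'a::comm_monoid_mult"
  by (simp only: UNIV_5 prod.insert finite_insert finite.emptyI insert_iff empty_iff neq_5 simp_thms
      prod.empty mult_1_right mult.assoc)

text \<open>The coefficients on the right are the Stirling numbers $S(k, q)$ of the second kind.\<close>

lemma alternating_sums_5:
  fixes a b :: "5 \<Rightarrow> int"
  defines "e2 \<equiv> a 0 * a 1 * b 2 * b 3 * b 4 + a 0 * b 1 * a 2 * b 3 * b 4 +
      a 0 * b 1 * b 2 * a 3 * b 4 + a 0 * b 1 * b 2 * b 3 * a 4 +
      b 0 * a 1 * a 2 * b 3 * b 4 + b 0 * a 1 * b 2 * a 3 * b 4 +
      b 0 * a 1 * b 2 * b 3 * a 4 + b 0 * b 1 * a 2 * a 3 * b 4 +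
      b 0 * b 1 * a 2 * b 3 * a 4 + b 0 * b 1 * b 2 * a 3 * a 4"
    and "e3 \<equiv> a 0 * a 1 * a 2 * b 3 * b 4 + a 0 * a 1 * b 2 * a 3 * b 4 +
      a 0 * a 1 * b 2 * b 3 * a 4 + a 0 * b 1 * a 2 * a 3 * b 4 +
      a 0 * b 1 * a 2 * b 3 * a 4 + a 0 * b 1 * b 2 * a 3 * a 4 +
      b 0 * a 1 * a 2 * a 3 * b 4 + b 0 * a 1 * a 2 * b 3 * a 4 +
      b 0 * a 1 * b 2 * a 3 * a 4 + b 0 * b 1 * a 2 * a 3 * a 4"
    and "e4 \<equiv> a 0 * a 1 * a 2 * a 3 * b 4 + a 0 * a 1 * a 2 * b 3 * a 4 +
      a 0 * a 1 * b 2 * a 3 * a 4 + a 0 * b 1 * a 2 * a 3 * a 4 +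
      b 0 * a 1 * a 2 * a 3 * a 4"
    and "e5 \<equiv> a 0 * a 1 * a 2 * a 3 * a 4"
  shows "(\<Sum>t\<le>2. (-1) ^ t * int (2 choose t) * (\<Prod>i\<in>UNIV. b i + (2 - int t) * a i))
      = 2 * (e2 + 3 * e3 + 7 * e4 + 15 * e5)" (is ?sum2)
    and "(\<Sum>t\<le>3. (-1) ^ t * int (3 choose t) * (\<Prod>i\<in>UNIV. b i + (3 - int t) * a i))
      = 6 * (e3 + 6 * e4 + 25 * e5)" (is ?sum3)
    and "(\<Sum>t\<le>4. (-1) ^ t * int (4 choose t) * (\<Prod>i\<in>UNIV. b i + (4 - int t) * a i))
      = 24 * (e4 + 10 * e5)" (is ?sum4)
    and "(\<Sum>t\<le>5. (-1) ^ t * int (5 choose t) * (\<Prod>i\<in>UNIV. b i + (5 - int t) * a i))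
      = 120 * e5" (is ?sum5)
proof -
  define e0 where "e0 = b 0 * b 1 * b 2 * b 3 * b 4"
  define e1 where "e1 = a 0 * b 1 * b 2 * b 3 * b 4 + b 0 * a 1 * b 2 * b 3 * b 4 +
      b 0 * b 1 * a 2 * b 3 * b 4 + b 0 * b 1 * b 2 * a 3 * b 4 +
      b 0 * b 1 * b 2 * b 3 * a 4"
  \<comment> \<open>The factor \<open>e_r\<close> (\<open>e0\<close> to \<open>e5\<close>) collects
    the products with \<open>r\<close> factors \<open>a\<close> and the rest \<open>b\<close>, so it
    is the coefficient of \<open>s ^ r\<close>.\<close>
  have expand: "(\<Prod>i\<in>UNIV. b i + s * a i)
      = e0 + s * e1 + s ^ 2 * e2 + s ^ 3 * e3 + s ^ 4 * e4 + s ^ 5 * e5" for s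
    unfolding prod_UNIV_5 e0_def e1_def e2_def e3_def e4_def e5_def by algebra
  have sets: "{..2 :: nat} = {0, 1, 2}" "{..3 :: nat} = {0, 1, 2, 3}"
    "{..4 :: nat} = {0, 1, 2, 3, 4}" "{..5 :: nat} = {0, 1, 2, 3, 4, 5}"
    by auto
  have chooses:
    "3 choose 2 = (3 :: nat)" "4 choose 2 = (6 :: nat)" "4 choose 3 = (4 :: nat)"
    "5 choose 2 = (10 :: nat)" "5 choose 3 = (10 :: nat)" "5 choose 4 = (5 :: nat)"
    by (simp_all add: binomial_eq_0 numeral_eq_Suc)
  \<comment> \<open>At \<open>s = q - t\<close>, the alternating sum of \<open>s ^ r\<close> counts
    the surjections from \<open>r\<close> points onto \<open>q\<close>: it vanishes for
    \<open>r < q\<close> and is \<open>fact q\<close> times $S(r, q)$ otherwise.\<close>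
  show ?sum2 ?sum3 ?sum4 ?sum5
    unfolding expand sets by (simp_all add: chooses)
qed

lemma sum_increasing_pairs_5:
  "(\<Sum>(i, j)\<in>{(i, j) |i j :: 5. i < j}. f i j) =
    f 0 1 + f 0 2 + f 0 3 + f 0 4
    + f 1 2 + f 1 3 + f 1 4 + f 2 3 + f 2 4 + f 3 4"
  for f :: "5 \<Rightarrow> 5 \<Rightarrow> 'a::comm_monoid_add"
  unfolding increasing_pairs_5
  by (simp only: sum.insert finite_insert finite.emptyI insert_iff empty_iff prod.inject neq_5 simp_thms
      sum.empty case_prod_conv add_0_right add.assoc)

lemma sum_increasing_triples_5:
  "(\<Sum>(i, j, k)\<in>{(i, j, k) |i j k :: 5. i < j \<and> j < k}. f i j k) =
    f 0 1 2 + f 0 1 3 + f 0 1 4 + f 0 2 3 + f 0 2 4 + f 0 3 4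
    + f 1 2 3 + f 1 2 4 + f 1 3 4 + f 2 3 4"
  for f :: "5 \<Rightarrow> 5 \<Rightarrow> 5 \<Rightarrow> 'a::comm_monoid_add"
  unfolding increasing_triples_5
  by (simp only: sum.insert finite_insert finite.emptyI insert_iff empty_iff prod.inject neq_5 simp_thms
      sum.empty case_prod_conv add_0_right add.assoc)

lemma sum_increasing_quadruples_5:
  "(\<Sum>(i, j, k, l)\<in>{(i, j, k, l) |i j k l :: 5. i < j \<and> j < k \<and> k < l}. f i j k l) =
    f 0 1 2 3 + f 0 1 2 4 + f 0 1 3 4 + f 0 2 3 4 + f 1 2 3 4"
  for f :: "5 \<Rightarrow> 5 \<Rightarrow> 5 \<Rightarrow> 5 \<Rightarrow> 'a::comm_monoid_add"
  unfolding increasing_quadruples_5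
  by (simp only: sum.insert finite_insert finite.emptyI insert_iff empty_iff prod.inject neq_5 simp_thms
      sum.empty case_prod_conv add_0_right add.assoc)

lemma sum_UNIV_5: "(\<Sum>i\<in>UNIV. f i) = f 0 + f 1 + f 2 + f 3 + f (4 :: 5)"
  for f :: "5 \<Rightarrow> 'a::comm_monoid_add"
  by (simp only: UNIV_5 sum.insert finite_insert finite.emptyI insert_iff empty_iff neq_5 simp_thms
      sum.empty add_0_right add.assoc)

theorem theorem3p12:
  fixes m :: "5 \<Rightarrow> nat"
  shows
    "let P = (\<Prod>i\<in>UNIV. m i);
         S2 = {(i, j) |i j :: 5. i < j};
         S3 = {(i, j, k) |i j k :: 5. i < j \<and> j < k};
         S4 = {(i, j, k, l) |i j k l :: 5. i < j \<and> j < k \<and> k < l}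
     in card {I :: (5, 'k::field) mpoly set. dominant_ideal I \<and> ideal_has_lcm I (monom_of m)} =
          1 + P ^ 4 + (\<Sum>(i, j)\<in>S2. m i * m j) + 3 * (\<Sum>(i, j, k)\<in>S3. m i * m j * m k)
          + 7 * (\<Sum>(i, j, k, l)\<in>S4. m i * m j * m k * m l) + 15 * P
          + 10 * P ^ 3 + (\<Sum>(i, j, k, l)\<in>S4. (m i * m j * m k * m l) ^ 3)
          + 6 * P ^ 2 * (\<Sum>(i, j, k, l)\<in>S4. m i * m j * m k * m l)
          + 4 * P * (\<Sum>(i, j, k, l)\<in>S4. (m i * m j * m k * m l) ^ 2)
          + 25 * P ^ 2 + (\<Sum>(i, j, k)\<in>S3. (m i * m j * m k) ^ 2)
          + 6 * (\<Sum>(i, j, k, l)\<in>S4. (m i * m j * m k * m l) ^ 2)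
          + 9 * P * (\<Sum>(i, j, k)\<in>S3. m i * m j * m k)
          + 18 * P * (\<Sum>(i, j, k, l)\<in>S4. m i * m j * m k * m l)
          + 3 * (\<Sum>i\<in>UNIV. m i *
                   (\<Sum>(j, k, l)\<in>{(j, k, l) \<in> S3. j \<noteq> i \<and> k \<noteq> i \<and> l \<noteq> i}. (m j * m k * m l) ^ 2))"
proof -
  define D where "D q =
    card {L :: 5 monom set. dominant_set L \<and> is_lcm_of (monom_of m) L \<and> card L = q}" for q
  define x where "x i = int (m i)" for i
  have D: "fact q * int (D q) = (\<Sum>t\<le>q. (-1) ^ t * int (q choose t) *
      (\<Prod>i\<in>UNIV. (x i + 1) ^ q - x i ^ q - int t * x i ^ (q - 1)))" if "q > 0" for q
  proof -
    have "fact q * D q = card (peak_matrices m q)"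
      unfolding D_def card_dominant_sets_of_card[OF that] lookup_monom_of ..
    then have "fact q * int (D q) = int (card (peak_matrices m q))"
      by (metis of_nat_fact of_nat_mult)
    then show ?thesis
      by (simp only: card_peak_matrices x_def of_nat_add of_nat_1)
  qed
  \<comment> \<open>One generator must be the lcm itself.\<close>
  have D1: "int (D 1) = 1"
    using D[of 1] by simp
  have facts: "fact 2 = (2 :: int)" "fact 3 = (6 :: int)" "fact 4 = (24 :: int)" "fact 5 = (120 :: int)"
    by (simp_all add: fact_numeral)
  have preds: "2 - 1 = (1 :: nat)" "3 - 1 = (2 :: nat)" "4 - 1 = (3 :: nat)" "5 - 1 = (4 :: nat)"
    by simp_all
  \<comment> \<open>In each factor, the summand without \<open>t\<close> counts the columns attaining their maximum at least twice.\<close>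
  have "(x i + 1) ^ 2 - x i ^ 2 - t * x i ^ (2 - 1) = 1 + (2 - t) * x i ^ 1" for i t
    unfolding preds by algebra
  then have "2 * int (D 2) = (\<Sum>t\<le>2. (-1) ^ t * int (2 choose t) *
      (\<Prod>i\<in>UNIV. 1 + (2 - int t) * x i ^ 1))"
    using D[of 2] by (simp only: facts zero_less_numeral simp_thms)
  \<comment> \<open>Here \<open>a\<close> counts the columns peaking at one given row and
    \<open>b\<close> those without a peak; the factor \<open>fact q\<close> cancels, as it does for
    \<open>D3\<close>, \<open>D4\<close> and \<open>D5\<close>.\<close>
  note D2 = mult_left_cancel[THEN iffD1, OF _ this[unfolded alternating_sums_5(1)
    [where b = "\<lambda>i. 1" and a = "\<lambda>i. x i ^ 1"]],
    OF zero_neq_numeral[symmetric]]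
  have "(x i + 1) ^ 3 - x i ^ 3 - t * x i ^ (3 - 1) = (3 * x i + 1) + (3 - t) * x i ^ 2" for i t
    unfolding preds by algebra
  then have "6 * int (D 3) = (\<Sum>t\<le>3. (-1) ^ t * int (3 choose t) *
      (\<Prod>i\<in>UNIV. (3 * x i + 1) + (3 - int t) * x i ^ 2))"
    using D[of 3] by (simp only: facts zero_less_numeral simp_thms)
  note D3 = mult_left_cancel[THEN iffD1, OF _ this[unfolded alternating_sums_5(2)
    [where b = "\<lambda>i. (3 * x i + 1)" and a = "\<lambda>i. x i ^ 2"]],
    OF zero_neq_numeral[symmetric]]
  have "(x i + 1) ^ 4 - x i ^ 4 - t * x i ^ (4 - 1)
      = (6 * x i ^ 2 + 4 * x i + 1) + (4 - t) * x i ^ 3" for i t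
    unfolding preds by algebra
  then have "24 * int (D 4) = (\<Sum>t\<le>4. (-1) ^ t * int (4 choose t) *
      (\<Prod>i\<in>UNIV. (6 * x i ^ 2 + 4 * x i + 1) + (4 - int t) * x i ^ 3))"
    using D[of 4] by (simp only: facts zero_less_numeral simp_thms)
  note D4 = mult_left_cancel[THEN iffD1, OF _ this[unfolded alternating_sums_5(3)
    [where b = "\<lambda>i. (6 * x i ^ 2 + 4 * x i + 1)" and a = "\<lambda>i. x i ^ 3"]],
    OF zero_neq_numeral[symmetric]]
  have "(x i + 1) ^ 5 - x i ^ 5 - t * x i ^ (5 - 1)
      = (10 * x i ^ 3 + 10 * x i ^ 2 + 5 * x i + 1) + (5 - t) * x i ^ 4" for i t
    unfolding preds by algebra
  then have "120 * int (D 5) = (\<Sum>t\<le>5. (-1) ^ t * int (5 choose t) *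
      (\<Prod>i\<in>UNIV. (10 * x i ^ 3 + 10 * x i ^ 2 + 5 * x i + 1) + (5 - int t) * x i ^ 4))"
    using D[of 5] by (simp only: facts zero_less_numeral simp_thms)
  note D5 = mult_left_cancel[THEN iffD1, OF _ this[unfolded alternating_sums_5(4)
    [where b = "\<lambda>i. (10 * x i ^ 3 + 10 * x i ^ 2 + 5 * x i + 1)" and a = "\<lambda>i. x i ^ 4"]],
    OF zero_neq_numeral[symmetric]]
  have "card {I :: (5, 'k) mpoly set. dominant_ideal I \<and> ideal_has_lcm I (monom_of m)}
      = (\<Sum>q=1..5. D q)"
    unfolding card_dominant_ideals D_def by simp
  also have "\<dots> = D 1 + D 2 + D 3 + D 4 + D 5"
    by (simp add: numeral_eq_Suc)
  finally have total: "int (card {I :: (5, 'k) mpoly set. dominant_ideal I \<and> ideal_has_lcm I (monom_of m)})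
      = 1 + int (D 2) + int (D 3) + int (D 4) + int (D 5)"
    using D1 by simp
  \<comment> \<open>Moving the exclusion of \<open>i\<close> into the summand lets the inner sum be
    evaluated by the same list of triples for every \<open>i\<close>.\<close>
  have inner: "(\<Sum>(j, k, l)\<in>{(j, k, l) \<in> {(i, j, k) |i j k :: 5. i < j \<and> j < k}.
      j \<noteq> i \<and> k \<noteq> i \<and> l \<noteq> i}. f j k l) =
      (\<Sum>(j, k, l)\<in>{(i, j, k) |i j k :: 5. i < j \<and> j < k}.
        if j \<noteq> i \<and> k \<noteq> i \<and> l \<noteq> i then f j k l else 0)"
    for f :: "5 \<Rightarrow> 5 \<Rightarrow> 5 \<Rightarrow> nat" and i
    by (rule sum.mono_neutral_cong_left) (auto simp: finite_subset[OF subset_UNIV])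
  show ?thesis
    \<comment> \<open>With all sums written out and cast to integers, the claim is a polynomial
      identity in the five values of \<open>x\<close>.\<close>
    unfolding Let_def inner sum_increasing_pairs_5 sum_increasing_triples_5 sum_increasing_quadruples_5
      sum_UNIV_5 prod_UNIV_5 of_nat_eq_iff[where 'a = int, symmetric] of_nat_add total D2 D3 D4 D5
    by (simp only: neq_5 simp_thms if_True if_False of_nat_add of_nat_mult of_nat_power of_nat_numeral
        of_nat_1 of_nat_0 x_def[symmetric]) algebra
qed

end
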